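(* Let $r,d\ge 1$ be integers. If $n_1,n_2\ge 0$ are integers with $n_1\equiv n_2\pmod d$, then $$(-1)^{n_1}D_r(n_1)\equiv(-1)^{n_2}D_r(n_2)\pmod d.$$ In particular, the sequence $(D_r(n)\bmod d)_{n\ge 0}$ is periodic of period $d$ if $d$ is even, and of period $2d$ if $d$ is odd.
   Context: For integers $n,r\ge 0$, the $r$-derangement number $D_r(n)$ is the number of permutations of $\{1,\dots,n+r\}$ that have no fixed points and in whose cycle decomposition the elements $1,\dots,r$ lie in pairwise distinct cycles; in particular $D_r(n)=0$ if $n<r$. A sequence $(a_n)_{n\ge n_0}$ is periodic of period $T$ if $a_{n+T}=a_n$ for all $n\ge n_0$; minimality of $T$ is not asserted. *)

theory Defs
  imports "HOL-Combinatorics.Orbits" "HOL-Number_Theory.Cong"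
begin

text \<open>For a permutation \<open>p\<close> of a finite set, \<open>orbit p i\<close> is the cycle of \<open>p\<close> through \<open>i\<close>
  (it contains \<open>i\<close> itself), so injectivity of \<open>orbit p\<close> on \<open>{1..r}\<close> says that \<open>1, \<dots>, r\<close>
  lie in pairwise distinct cycles.\<close>

definition r_derangements :: "nat \<Rightarrow> nat \<Rightarrow> (nat \<Rightarrow> nat) set" where
  "r_derangements r n =
     {p. p permutes {1..n + r} \<and> (\<forall>i\<in>{1..n + r}. p i \<noteq> i) \<and> inj_on (orbit p) {1..r}}"

definition r_derangement_number :: "nat \<Rightarrow> nat \<Rightarrow> nat" where
  "r_derangement_number r n = card (r_derangements r n)"

text \<open>The period need not be minimal.\<close>

definition periodic_from :: "nat \<Rightarrow> (nat \<Rightarrow> 'a) \<Rightarrow> nat \<Rightarrow> bool" where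
  "periodic_from n0 a T \<longleftrightarrow> (\<forall>n\<ge>n0. a (n + T) = a n)"

end

theory Submission
  imports Defs Complex_Main
begin

text \<open>Drop the condition on fixed points first. A permutation of \<open>R \<union> N\<close> with the elements of \<open>R\<close> in
  distinct cycles is built by inserting the elements of \<open>N\<close> one after the other, either as a new cycle
  or behind an element already present, so with \<open>a = card R\<close> and \<open>k = card N\<close> there are
  \<open>(a + 1) \<dots> (a + k) = k! (a + k choose k)\<close> of them. Inclusion-exclusion over the set of fixed
  points, split into its part \<open>S\<close> in \<open>{1..r}\<close> and the rest, then writes \<open>(-1)\<^sup>n D\<^sub>r(n)\<close> as a signed
  sum over \<open>S\<close> and \<open>k\<close> of \<open>(r - card S + k choose k) n (n - 1) \<dots> (n - k + 1)\<close>. Only the falling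
  factorials depend on \<open>n\<close>. They are integer polynomials in \<open>n\<close>, hence determined modulo \<open>d\<close> by
  \<open>n\<close> modulo \<open>d\<close>, and they vanish for \<open>k > n\<close>, so the range of \<open>k\<close> does not matter.\<close>

section \<open>Counting permutations with prescribed elements in distinct cycles\<close>

definition separating_perms :: "'a set \<Rightarrow> 'a set \<Rightarrow> ('a \<Rightarrow> 'a) set" where
  "separating_perms R A = {p. p permutes A \<and> inj_on (orbit p) R}"

lemma finite_separating_perms: "finite A \<Longrightarrow> finite (separating_perms R A)"
  unfolding separating_perms_def by (rule finite_subset[OF _ finite_permutations]) auto

text \<open>The orbits of a permutation with finite support partition the points, so two orbits
  coincide as soon as one contains the base point of the other. This reduces separation to
  membership in orbits.\<close>

lemma inj_on_orbit_iff:
  assumes "p permutes A" "finite A"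
  shows "inj_on (orbit p) R \<longleftrightarrow> (\<forall>i\<in>R. \<forall>j\<in>R. j \<in> orbit p i \<longrightarrow> j = i)"
proof -
  have "permutation p"
    using assms by (auto simp: permutation_permutes)
  then have "orbit p i = orbit p j \<longleftrightarrow> j \<in> orbit p i" for i j
    by (metis cyclic_on_orbit' orbit_cyclic_eq3 permutation_self_in_orbit)
  then show ?thesis
    unfolding inj_on_def by blast
qed

text \<open>Since \<open>q\<close> fixes \<open>a\<close>, composing with the transposition inserts
  \<open>a\<close> into a cycle of \<open>q\<close> directly before \<open>b\<close>, or leaves it
  as a cycle of its own when \<open>b = a\<close>. The old elements stay distributed over cycles as
  before.\<close>

lemma orbit_transpose_comp_iff:
  assumes q: "q permutes S" and a: "a \<notin> S" and b: "b \<in> insert a S"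
    and z: "z \<in> S" and y: "y \<in> S"
  shows "y \<in> orbit (transpose a b \<circ> q) z \<longleftrightarrow> y \<in> orbit q z"
proof (cases "b = a")
  case True
  then show ?thesis by simp
next
  case False
  let ?p = "transpose a b \<circ> q"
  have qa: "q a = a"
    using q a by (simp add: permutes_not_in)
  have pa: "?p a = b"
    using qa by simp
  have qS: "q x \<noteq> a" if "x \<noteq> a" for x
    using qa that permutes_inj[OF q] by (metis injD)
  have p_hit: "?p x = a" if "q x = b" for x
    using that by simp
  have p_miss: "?p x = q x" if "x \<noteq> a" "q x \<noteq> b" for x
    using that qS[of x] by (simp add: transpose_apply_other)
  have za: "z \<noteq> a"
    using z a by blast
  \<comment> \<open>The orbit of \<open>?p\<close> may pass through the new point \<open>a\<close>;
    the invariant then tracks \<open>b\<close>, its successor under \<open>?p\<close>.\<close>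
  have 1: "(y \<noteq> a \<longrightarrow> y \<in> orbit q z) \<and> (y = a \<longrightarrow> b \<in> orbit q z)" if "y \<in> orbit ?p z" for y
    using that
  proof induction
    case base
    show ?case
      using za orbit.base[of q z] p_hit[of z] p_miss[of z] False qS[of z] by metis
  next
    case (step y)
    show ?case
    proof (cases "y = a")
      case True
      then show ?thesis
        using step.IH pa False by simp
    next
      case ya: False
      then have "q y \<in> orbit q z"
        using step.IH by (simp add: orbit.step)
      then show ?thesis
        using ya p_hit[of y] p_miss[of y] False qS[of y] by metis
    qed
  qed
  \<comment> \<open>One step of \<open>q\<close> is one step of \<open>?p\<close>, or two when it
    leads to \<open>b\<close>: the detour passes through \<open>a\<close>.\<close>
  have 2: "y \<in> orbit ?p z" if "y \<in> orbit q z" for y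
    using that
  proof induction
    case base
    show ?case
      using za p_hit[of z] p_miss[of z] pa orbit.base[of ?p z] orbit.step[of "?p z" ?p z] by metis
  next
    case (step y)
    have "y \<in> S"
      using step.hyps permutes_orbit_subset[OF q z] by blast
    then have "y \<noteq> a"
      using a by blast
    then show ?case
      using p_hit[of y] p_miss[of y] pa orbit.step[OF step.IH] orbit.step[of "?p y" ?p z] by metis
  qed
  show ?thesis
    using 1[of y] 2[of y] y a by blast
qed

text \<open>Both \<open>p\<close> and \<open>q\<close> fix \<open>a\<close>, so the composite sends
  \<open>a\<close> to \<open>b\<close>, respectively \<open>c\<close>; once these agree, the
  transposition cancels.\<close>

lemma transpose_comp_eq_iff:
  assumes "p permutes S" "q permutes S" "a \<notin> S"
  shows "transpose a b \<circ> p = transpose a c \<circ> q \<longleftrightarrow> b = c \<and> p = q"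
proof
  assume eq: "transpose a b \<circ> p = transpose a c \<circ> q"
  have "p a = a" "q a = a"
    using assms by (simp_all add: permutes_not_in)
  then have bc: "b = c"
    using fun_cong[OF eq, of a] by simp
  have "transpose a b \<circ> (transpose a b \<circ> p) = transpose a b \<circ> (transpose a b \<circ> q)"
    using eq bc by simp
  then have "p = q"
    by (simp add: o_assoc)
  then show "b = c \<and> p = q"
    using bc by simp
qed simp

text \<open>Each permutation of \<open>insert a S\<close> is uniquely a transposition of
  \<open>a\<close> with some \<open>b\<close> after a permutation of \<open>S\<close>. The choice of
  \<open>b\<close> is free, as it does not affect the separation of elements of
  \<open>S\<close>.\<close>

lemma card_separating_perms_insert:
  assumes "finite S" "a \<notin> S" "R \<subseteq> S"
  shows "card (separating_perms R (insert a S)) = Suc (card S) * card (separating_perms R S)"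
proof -
  let ?g = "\<lambda>(b, p). transpose a b \<circ> p"
  have perm: "transpose a b \<circ> q permutes insert a S"
    if "q permutes S" "b \<in> insert a S" for b q
    using permutes_compose[OF permutes_subset[OF that(1) subset_insertI]
        permutes_swap_id[OF insertI1 that(2)]] .
  have sep: "inj_on (orbit (transpose a b \<circ> q)) R \<longleftrightarrow> inj_on (orbit q) R"
    if "q permutes S" "b \<in> insert a S" for b q
  proof -
    have "j \<in> orbit (transpose a b \<circ> q) i \<longleftrightarrow> j \<in> orbit q i" if "i \<in> R" "j \<in> R" for i j
      using orbit_transpose_comp_iff[OF \<open>q permutes S\<close> \<open>a \<notin> S\<close> \<open>b \<in> insert a S\<close>] that \<open>R \<subseteq> S\<close>
      by blast
    then show ?thesis
      using that perm[OF that] \<open>finite S\<close> by (simp add: inj_on_orbit_iff)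
  qed
  have "separating_perms R (insert a S) = ?g ` (insert a S \<times> separating_perms R S)"
    (is "?L = ?g ` ?D")
  proof
    show "?L \<subseteq> ?g ` ?D"
    proof
      fix p assume p: "p \<in> ?L"
      then have "p \<in> ?g ` {(b, q). b \<in> insert a S \<and> q \<in> {q. q permutes S}}"
        unfolding permutes_insert[symmetric] by (simp add: separating_perms_def)
      then obtain b q where bq: "b \<in> insert a S" "q permutes S" "p = transpose a b \<circ> q"
        by auto
      then have "(b, q) \<in> ?D"
        using p sep[OF bq(2,1)] by (simp add: separating_perms_def)
      then show "p \<in> ?g ` ?D"
        using bq(3) by (force intro: image_eqI[of _ _ "(b, q)"])
    qed
    show "?g ` ?D \<subseteq> ?L"
      using perm sep by (auto simp: separating_perms_def)
  qed
  moreover have "inj_on ?g ?D"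
  proof (rule inj_onI)
    fix u v assume "u \<in> ?D" "v \<in> ?D" "?g u = ?g v"
    then show "u = v"
      using transpose_comp_eq_iff[of "snd u" S "snd v" a "fst u" "fst v"] \<open>a \<notin> S\<close>
      by (simp add: separating_perms_def mem_Times_iff case_prod_unfold prod_eq_iff)
  qed
  ultimately show ?thesis
    using \<open>finite S\<close> \<open>a \<notin> S\<close> by (simp add: card_image card_cartesian_product)
qed

text \<open>Base case of the count: \<open>p x\<close> lies in the cycle of \<open>x\<close>, so
  separating all points forces \<open>p x = x\<close>.\<close>

lemma separating_perms_self:
  assumes "finite R"
  shows "separating_perms R R = {id}"
proof -
  have "p = id" if p: "p permutes R" and inj: "inj_on (orbit p) R" for p
  proof
    fix x
    show "p x = id x"
    proof (cases "x \<in> R")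
      case True
      then have "p x \<in> R"
        using p by (simp add: permutes_in_image)
      then show ?thesis
        using True inj inj_on_orbit_iff[OF p assms, of R] orbit.base[of p x] by simp
    qed (use p in \<open>simp add: permutes_not_in\<close>)
  qed
  moreover have "inj_on (orbit id) R"
    using assms by (subst inj_on_orbit_iff[of _ R]) (auto simp: orbit_altdef)
  ultimately show ?thesis
    by (auto simp: separating_perms_def)
qed

lemma card_separating_perms:
  assumes "finite R" "finite N" "R \<inter> N = {}"
  shows "card (separating_perms R (R \<union> N)) = fact (card N) * (card R + card N choose card N)"
  using assms(2,3)
proof (induction N)
  case empty
  then show ?case
    by (simp add: separating_perms_self assms(1))
next
  case (insert a N)
  let ?r = "card R" and ?n = "card N"
  have "card (R \<union> N) = ?r + ?n"
    using insert assms(1) by (simp add: card_Un_disjoint)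
  then have "card (separating_perms R (insert a (R \<union> N)))
      = Suc (?r + ?n) * (fact ?n * (?r + ?n choose ?n))"
    using insert assms(1) by (subst card_separating_perms_insert) auto
  also have "\<dots> = fact ?n * (Suc (?r + ?n) * (?r + ?n choose ?n))"
    by (simp only: mult.left_commute)
  \<comment> \<open>Absorption identity for binomial coefficients.\<close>
  also have "\<dots> = fact ?n * (Suc ?n * (Suc (?r + ?n) choose Suc ?n))"
    by (simp only: Suc_times_binomial)
  finally show ?case
    using insert by (simp add: algebra_simps)
qed

section \<open>Inclusion-exclusion over fixed points\<close>

lemma separating_perms_fixing:
  assumes "finite A" "R \<subseteq> A" "X \<subseteq> A"
  shows "{p \<in> separating_perms R A. \<forall>x\<in>X. p x = x} = separating_perms (R - X) (A - X)"
proof -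
  have perm: "p permutes A \<and> (\<forall>x\<in>X. p x = x) \<longleftrightarrow> p permutes A - X" for p
    using permutes_superset[of p A "A - X"] permutes_subset[of p "A - X" A]
      permutes_not_in[of p "A - X"] by auto
  have "inj_on (orbit p) R \<longleftrightarrow> inj_on (orbit p) (R - X)" if p: "p permutes A - X" for p
  proof -
    have fix_X: "orbit p x = {x}" if "x \<in> X" for x
      using permutes_not_in[OF p, of x] that by (simp add: orbit_eq_singleton_iff)
    \<comment> \<open>Orbits starting in \<open>R - X\<close> stay inside \<open>A - X\<close>, so
      the singleton cycles of \<open>X\<close> never collide with them.\<close>
    have "x \<notin> orbit p y" if "y \<in> R - X" "x \<in> X" for x y
      using permutes_orbit_subset[OF p, of y] that assms by blast
    then show ?thesis
      using fix_X assms p by (subst (1 2) inj_on_orbit_iff[OF p]) blast+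
  qed
  then show ?thesis
    using perm by (auto simp: separating_perms_def)
qed

lemma card_fixpoint_free_separating_perms:
  assumes "finite A" "R \<subseteq> A"
  shows "int (card {p \<in> separating_perms R A. \<forall>x\<in>A. p x \<noteq> x})
    = (\<Sum>X\<in>Pow A. (-1) ^ card X * int (card (separating_perms (R - X) (A - X))))"
proof -
  let ?P = "separating_perms R A"
  have fin: "finite ?P"
    by (rule finite_separating_perms[OF assms(1)])
  have "int (card {p \<in> ?P. \<forall>x\<in>A. p x \<noteq> x}) = (\<Sum>p\<in>?P. of_bool (\<forall>x\<in>A. p x \<noteq> x))"
    using fin by (simp add: of_bool_def sum.If_cases Int_def)
  also have "\<dots> = (\<Sum>p\<in>?P. \<Sum>X\<in>Pow A. (-1) ^ card X * of_bool (\<forall>x\<in>X. p x = x))"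
  proof (rule sum.cong[OF refl])
    fix p
    \<comment> \<open>Inclusion-exclusion for a single \<open>p\<close>: expand the product of
      \<open>1 - [p x = x]\<close>, where \<open>X\<close> collects the points contributing the
      second term.\<close>
    have "of_bool (\<forall>x\<in>A. p x \<noteq> x) = (\<Prod>x\<in>A. 1 - of_bool (p x = x) :: int)"
      using assms(1) by (cases "\<forall>x\<in>A. p x \<noteq> x") auto
    also have "\<dots> = (\<Sum>X\<in>Pow A. (-1) ^ card X * (\<Prod>x\<in>X. of_bool (p x = x)) * (\<Prod>x\<in>A-X. 1))"
      by (rule prod_diff_conv_sum[OF assms(1)])
    also have "\<dots> = (\<Sum>X\<in>Pow A. (-1) ^ card X * of_bool (\<forall>x\<in>X. p x = x))"
    proof (rule sum.cong[OF refl])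
      fix X assume "X \<in> Pow A"
      then have "finite X"
        using assms(1) by (auto intro: finite_subset)
      then have "(\<Prod>x\<in>X. of_bool (p x = x)) = (of_bool (\<forall>x\<in>X. p x = x) :: int)"
        by (cases "\<forall>x\<in>X. p x = x") auto
      then show "(-1) ^ card X * (\<Prod>x\<in>X. of_bool (p x = x)) * (\<Prod>x\<in>A-X. 1)
          = ((-1) ^ card X * of_bool (\<forall>x\<in>X. p x = x) :: int)"
        by simp
    qed
    finally show "of_bool (\<forall>x\<in>A. p x \<noteq> x)
        = (\<Sum>X\<in>Pow A. (-1) ^ card X * of_bool (\<forall>x\<in>X. p x = x) :: int)" .
  qed
  also have "\<dots> = (\<Sum>X\<in>Pow A. (-1) ^ card X * (\<Sum>p\<in>?P. of_bool (\<forall>x\<in>X. p x = x)))"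
    by (subst sum.swap) (simp add: sum_distrib_left)
  also have "\<dots> = (\<Sum>X\<in>Pow A. (-1) ^ card X * int (card (separating_perms (R - X) (A - X))))"
  proof (rule sum.cong[OF refl])
    fix X assume "X \<in> Pow A"
    then show "(-1) ^ card X * (\<Sum>p\<in>?P. of_bool (\<forall>x\<in>X. p x = x))
        = (-1) ^ card X * int (card (separating_perms (R - X) (A - X)))"
      using fin separating_perms_fixing[OF assms, of X, symmetric]
      by (simp add: of_bool_def sum.If_cases Int_def)
  qed
  finally show ?thesis .
qed

section \<open>Explicit formula for the r-derangement numbers\<close>

lemma sum_Pow_card:
  fixes f :: "nat \<Rightarrow> 'b::semiring_1"
  assumes "finite N"
  shows "(\<Sum>T\<in>Pow N. f (card T)) = (\<Sum>k\<le>card N. of_nat (card N choose k) * f k)"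
proof -
  have "(\<Sum>T\<in>Pow N. f (card T))
      = (\<Sum>k\<le>card N. \<Sum>T\<in>{T \<in> Pow N. card T = k}. f (card T))"
    using assms by (intro sum.group[symmetric]) (auto intro: card_mono)
  also have "\<dots> = (\<Sum>k\<le>card N. of_nat (card N choose k) * f k)"
    using assms by (intro sum.cong refl) (simp add: n_subsets)
  finally show ?thesis .
qed

lemma sum_Pow_Un_disjoint:
  assumes "R \<inter> N = {}"
  shows "(\<Sum>X\<in>Pow (R \<union> N). f X) = (\<Sum>S\<in>Pow R. \<Sum>T\<in>Pow N. f (S \<union> T))"
proof -
  have "(\<Sum>X\<in>Pow (R \<union> N). f X) = (\<Sum>(S, T)\<in>Pow R \<times> Pow N. f (S \<union> T))"
    using assms by (intro sum.reindex_bij_witness[of _ "\<lambda>(S, T). S \<union> T" "\<lambda>X. (X \<inter> R, X \<inter> N)"])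
      (auto intro: arg_cong[of _ _ f])
  then show ?thesis
    by (simp add: sum.cartesian_product)
qed

text \<open>The falling factorial as an integer polynomial in \<open>n\<close>. It is also correct
  for \<open>k > n\<close>, where the factor at \<open>i = n\<close> vanishes.\<close>

lemma choose_mult_fact_eq_prod:
  "int (n choose k) * fact k = (\<Prod>i<k. int n - int i)"
proof -
  have "of_int (int (n choose k) * fact k) = (of_int (\<Prod>i<k. int n - int i) :: real)"
    using gbinomial_mult_fact[of k "of_nat n :: real"]
    by (simp add: binomial_gbinomial atLeast0LessThan mult.commute)
  then show ?thesis
    by (simp only: of_int_eq_iff)
qed

lemma r_derangement_number_eq:
  "(-1) ^ n * int (r_derangement_number r n) =
    (\<Sum>S\<in>Pow {1..r}. (-1) ^ card S *
      (\<Sum>k\<le>n. (-1) ^ k * int (r - card S + k choose k) * (\<Prod>i<k. int n - int i)))"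
proof -
  let ?R = "{1..r}" and ?N = "{r+1..r+n}"
  have disj: "?R \<inter> ?N = {}" and un: "?R \<union> ?N = {1..n+r}"
    by auto
  have inner: "(\<Sum>T\<in>Pow ?N. (-1) ^ card (S \<union> T) *
        int (card (separating_perms (?R - (S \<union> T)) (?R \<union> ?N - (S \<union> T)))))
      = (-1) ^ n * ((-1) ^ card S *
      (\<Sum>k\<le>n. (-1) ^ k * int (r - card S + k choose k) * (\<Prod>i<k. int n - int i)))"
    (is "?lhs = _") if S: "S \<in> Pow ?R" for S
  proof -
    \<comment> \<open>Here \<open>k\<close> is the number of elements of \<open>?N\<close> outside
      the prescribed fixed points. The exponent \<open>n + k\<close> has the parity of
      \<open>n - k\<close> and avoids truncated subtraction.\<close>
    define f :: "nat \<Rightarrow> int"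
      where "f k = (-1) ^ card S * (-1) ^ (n + k) * (fact k * int (r - card S + k choose k))" for k
    have "?lhs = (\<Sum>T\<in>Pow ?N. f (card T))"
    \<comment> \<open>Pass from \<open>T\<close> to its complement in \<open>?N\<close>, whose size
      is the \<open>k\<close> of the formula.\<close>
    proof (rule sum.reindex_bij_witness[of _ "\<lambda>T. ?N - T" "\<lambda>T. ?N - T"])
      fix T assume T: "T \<in> Pow ?N"
      have fin: "finite S" "finite T"
        using S T by (auto intro: finite_subset)
      have "card (S \<union> T) = card S + card T"
        using fin by (intro card_Un_disjoint) (use S T disj in blast)+
      moreover have "?R - (S \<union> T) = ?R - S" "?R \<union> ?N - (S \<union> T) = (?R - S) \<union> (?N - T)"
        using S T disj by auto
      moreover have "card (?R - S) = r - card S" "card (?N - T) = n - card T" "card T \<le> n"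
        using S T fin card_mono[of ?N T] by (simp_all add: card_Diff_subset)
      moreover have "card (separating_perms (?R - S) ((?R - S) \<union> (?N - T)))
          = fact (card (?N - T)) * (card (?R - S) + card (?N - T) choose card (?N - T))"
        using disj by (intro card_separating_perms) auto
      ultimately show "f (card (?N - T)) = (-1) ^ card (S \<union> T) *
          int (card (separating_perms (?R - (S \<union> T)) (?R \<union> ?N - (S \<union> T))))"
        by (simp add: f_def power_add[symmetric] minus_one_power_iff)
    qed auto
    also have "\<dots> = (\<Sum>k\<le>n. int (n choose k) * f k)"
      by (simp add: sum_Pow_card)
    also have "\<dots> = (-1) ^ n * ((-1) ^ card S *
      (\<Sum>k\<le>n. (-1) ^ k * int (r - card S + k choose k) * (\<Prod>i<k. int n - int i)))"
      unfolding choose_mult_fact_eq_prod[symmetric]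
      by (simp add: f_def sum_distrib_left power_add algebra_simps)
    finally show ?thesis .
  qed
  have "r_derangements r n = {p \<in> separating_perms ?R (?R \<union> ?N). \<forall>x\<in>?R \<union> ?N. p x \<noteq> x}"
    unfolding r_derangements_def separating_perms_def un by auto
  then have "int (r_derangement_number r n) =
     (\<Sum>X\<in>Pow (?R \<union> ?N). (-1) ^ card X *
        int (card (separating_perms (?R - X) (?R \<union> ?N - X))))"
    unfolding r_derangement_number_def
    by (simp only: card_fixpoint_free_separating_perms[of "?R \<union> ?N" ?R] finite_Un
        finite_atLeastAtMost Un_upper1 simp_thms)
  also have "\<dots> = (-1) ^ n * (\<Sum>S\<in>Pow {1..r}. (-1) ^ card S *
      (\<Sum>k\<le>n. (-1) ^ k * int (r - card S + k choose k) * (\<Prod>i<k. int n - int i)))"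
    unfolding sum_Pow_Un_disjoint[OF disj] sum_distrib_left
    by (intro sum.cong[OF refl]) (use inner in \<open>simp add: sum_distrib_left\<close>)
  \<comment> \<open>The two factors \<open>(-1) ^ n\<close> cancel.\<close>
  finally show ?thesis
    by (simp add: power_add[symmetric] mult.assoc[symmetric])
qed

section \<open>Congruence and periodicity\<close>

lemma sum_falling_factorial_cong:
  fixes c :: "nat \<Rightarrow> int"
  assumes "[n = m] (mod d)"
  shows "[(\<Sum>k\<le>n. c k * (\<Prod>i<k. int n - int i)) = (\<Sum>k\<le>m. c k * (\<Prod>i<k. int m - int i))] (mod int d)"
proof -
  \<comment> \<open>For \<open>k > n\<close> the product contains the factor
    \<open>int n - int n\<close>, so both sums may run up to \<open>max n m\<close>.\<close>
  have extend: "(\<Sum>k\<le>n. c k * (\<Prod>i<k. int n - int i)) = (\<Sum>k\<le>l. c k * (\<Prod>i<k. int n - int i))"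
    if "n \<le> l" for n l
    using that by (intro sum.mono_neutral_left) (auto intro!: prod_zero)
  have "[int n = int m] (mod int d)"
    using assms by (simp add: cong_int_iff)
  \<comment> \<open>Over a common range only the factors differ, and they are congruent one by
    one.\<close>
  then have "[(\<Sum>k\<le>max n m. c k * (\<Prod>i<k. int n - int i))
      = (\<Sum>k\<le>max n m. c k * (\<Prod>i<k. int m - int i))] (mod int d)"
    by (intro cong_sum cong_scalar_left cong_prod cong_diff cong_refl)
  then show ?thesis
    using extend[of n "max n m"] extend[of m "max n m"] by simp
qed

theorem theorem11:
  fixes r d :: nat
  assumes "r \<ge> 1" and "d \<ge> 1"
  shows "(\<forall>n1 n2 :: nat. [n1 = n2] (mod d) \<longrightarrow>
            [(-1) ^ n1 * int (r_derangement_number r n1)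
               = (-1) ^ n2 * int (r_derangement_number r n2)] (mod int d))
       \<and> (even d \<longrightarrow> periodic_from 0 (\<lambda>n. r_derangement_number r n mod d) d)
       \<and> (odd d \<longrightarrow> periodic_from 0 (\<lambda>n. r_derangement_number r n mod d) (2 * d))"
proof -
  have main: "[(-1) ^ n1 * int (r_derangement_number r n1)
               = (-1) ^ n2 * int (r_derangement_number r n2)] (mod int d)"
    if "[n1 = n2] (mod d)" for n1 n2
    unfolding r_derangement_number_eq
    by (intro cong_sum cong_scalar_left sum_falling_factorial_cong that)
  \<comment> \<open>Evenness of \<open>T\<close> makes the signs at \<open>n + T\<close> and
    \<open>n\<close> agree; \<open>T\<close> is \<open>d\<close> for even \<open>d\<close> and
    \<open>2 * d\<close> for odd \<open>d\<close>.\<close>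
  have period: "periodic_from 0 (\<lambda>n. r_derangement_number r n mod d) T"
    if "d dvd T" "even T" for T
    unfolding periodic_from_def
  proof (intro allI impI)
    fix n
    have "[n + T = n] (mod d)"
      using that(1) by (simp add: cong_def mod_add_right_eq dvd_eq_mod_eq_0 flip: mod_add_right_eq)
    \<comment> \<open>Multiplying by \<open>(-1) ^ n\<close> removes the common sign.\<close>
    from cong_scalar_left[OF main[OF this], of "(-1) ^ n"]
    have "[int (r_derangement_number r (n + T)) = int (r_derangement_number r n)] (mod int d)"
      using that(2) by (cases "even n") simp_all
    then show "r_derangement_number r (n + T) mod d = r_derangement_number r n mod d"
      unfolding cong_int_iff by (simp add: cong_def)
  qed
  show ?thesis
    using main period by auto
qed

end
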